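(* Let $C>0$. The probability that a GSAW with nearest-neighbor weighting (with constant $C$) on $L_\infty$ terminates is $1$.
   Context: $L_\infty$ is the graph with vertex set $\{(a,b): a\in\mathbb{Z},\ b\in\{1,2\}\}$, where $(a,b)$ and $(a',b')$ are adjacent iff ($b=b'$ and $|a-a'|=1$) or ($a=a'$ and $b\ne b'$). All starting vertices are equivalent by symmetry. GSAW (growing self-avoiding walk) with nearest-neighbor weighting (constant $C>0$): the random process which starts at a given vertex and, if the path so far is $P=(v_1,\dots,v_n)$, assigns to each unvisited vertex $w$ the energy $E(w)=C^{k(w)}$, where $k(w)$ is the number of neighbors of $w$ lying in $P\setminus\{v_n\}$. The next vertex is chosen among the unvisited neighbors of $v_n$, with $w$ chosen with probability proportional to $E(w)$. The walk terminates when $v_n$ has no unvisited neighbor. *)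

theory Defs
  imports "HOL-Probability.Probability"
begin

text \<open>A graph is given by its (symmetric, irreflexive, locally finite) adjacency relation
  \<open>adj\<close>. A path \<open>(v\<^sub>1, \<dots>, v\<^sub>n)\<close> is a nonempty list whose last element is the current
  vertex \<open>v\<^sub>n\<close>.\<close>

definition free_neighbors :: "('v \<Rightarrow> 'v \<Rightarrow> bool) \<Rightarrow> 'v list \<Rightarrow> 'v set" where
  "free_neighbors adj p = {w. adj (last p) w \<and> w \<notin> set p}"

definition nn_energy :: "('v \<Rightarrow> 'v \<Rightarrow> bool) \<Rightarrow> real \<Rightarrow> 'v list \<Rightarrow> 'v \<Rightarrow> real" where
  "nn_energy adj C p w = C ^ card {u \<in> set p - {last p}. adj w u}"

text \<open>The law of the next vertex. The weights below do form a probability mass function if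
  \<open>C > 0\<close> and \<open>free_neighbors adj p\<close> is finite and nonempty, see \<open>pmf_gsaw_next\<close>.\<close>

definition gsaw_next :: "('v \<Rightarrow> 'v \<Rightarrow> bool) \<Rightarrow> real \<Rightarrow> 'v list \<Rightarrow> 'v pmf" where
  "gsaw_next adj C p = embed_pmf (\<lambda>w.
     if w \<in> free_neighbors adj p
     then nn_energy adj C p w / (\<Sum>u\<in>free_neighbors adj p. nn_energy adj C p u)
     else 0)"

text \<open>The process is modelled on trajectories \<open>\<omega> :: nat \<Rightarrow> 'v list\<close>, where \<open>\<omega> n\<close> is the
  whole path after \<open>n\<close> steps. Once the walk has terminated, the path no longer changes.\<close>

definition gsaw_step :: "('v \<Rightarrow> 'v \<Rightarrow> bool) \<Rightarrow> real \<Rightarrow> 'v list \<Rightarrow> 'v list pmf" where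
  "gsaw_step adj C p =
     (if free_neighbors adj p = {} then return_pmf p
      else map_pmf (\<lambda>w. p @ [w]) (gsaw_next adj C p))"

definition gsaw_kernel ::
  "('v \<Rightarrow> 'v \<Rightarrow> bool) \<Rightarrow> real \<Rightarrow> 'v \<Rightarrow> nat \<Rightarrow> (nat \<Rightarrow> 'v list) \<Rightarrow> 'v list measure" where
  "gsaw_kernel adj C v n \<omega> =
     measure_pmf (case n of 0 \<Rightarrow> return_pmf [v] | Suc m \<Rightarrow> gsaw_step adj C (\<omega> m))"

text \<open>The law of the walk started at \<open>v\<close>: the measure on infinite trajectories that the
  Ionescu-Tulcea theorem yields for these transition kernels. See \<open>gsaw_0\<close> and
  \<open>gsaw_Suc\<close> for its finite-dimensional distributions.\<close>

definition gsaw ::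
  "('v \<Rightarrow> 'v \<Rightarrow> bool) \<Rightarrow> real \<Rightarrow> 'v \<Rightarrow> (nat \<Rightarrow> 'v list) measure" where
  "gsaw adj C v = projective_family.lim UNIV
     (Ionescu_Tulcea.CI (gsaw_kernel adj C v) (\<lambda>_. count_space UNIV)) (\<lambda>_. count_space UNIV)"

definition gsaw_terminates :: "('v \<Rightarrow> 'v \<Rightarrow> bool) \<Rightarrow> (nat \<Rightarrow> 'v list) \<Rightarrow> bool" where
  "gsaw_terminates adj \<omega> \<longleftrightarrow> (\<exists>n. free_neighbors adj (\<omega> n) = {})"

definition ladder_verts :: "(int \<times> nat) set" where
  "ladder_verts = UNIV \<times> {1, 2}"

definition ladder_adj :: "int \<times> nat \<Rightarrow> int \<times> nat \<Rightarrow> bool" where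
  "ladder_adj x y \<longleftrightarrow> x \<in> ladder_verts \<and> y \<in> ladder_verts \<and>
     (snd x = snd y \<and> \<bar>fst x - fst y\<bar> = 1 \<or> fst x = fst y \<and> snd x \<noteq> snd y)"

lemma finite_free_neighbors_ladder: "finite (free_neighbors ladder_adj p)"
proof (rule finite_subset)
  show "free_neighbors ladder_adj p \<subseteq> {fst (last p) - 1 .. fst (last p) + 1} \<times> {1, 2}"
    by (auto simp: free_neighbors_def ladder_adj_def ladder_verts_def)
qed auto

lemma pmf_gsaw_next:
  assumes "C > 0" "finite (free_neighbors adj p)" "free_neighbors adj p \<noteq> {}"
  shows "pmf (gsaw_next adj C p) w =
     (if w \<in> free_neighbors adj p
      then nn_energy adj C p w / (\<Sum>u\<in>free_neighbors adj p. nn_energy adj C p u)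
      else 0)"
proof -
  let ?U = "free_neighbors adj p"
  define S where "S = (\<Sum>u\<in>?U. nn_energy adj C p u)"
  define f where "f w = (if w \<in> ?U then nn_energy adj C p w / S else 0)" for w
  have pos: "nn_energy adj C p u > 0" for u
    using assms(1) by (simp add: nn_energy_def)
  have S: "S > 0"
    unfolding S_def using assms pos by (intro sum_pos) auto
  have nonneg: "f w \<ge> 0" for w
    using pos[of w] S by (simp add: f_def)
  have "(\<integral>\<^sup>+w. ennreal (f w) \<partial>count_space UNIV) = (\<Sum>w\<in>?U. ennreal (f w))"
    using assms(2) by (intro nn_integral_count_space') (auto simp: f_def)
  also have "\<dots> = ennreal (\<Sum>w\<in>?U. f w)"
    using nonneg by (simp add: sum_ennreal)
  also have "(\<Sum>w\<in>?U. f w) = (\<Sum>w\<in>?U. nn_energy adj C p w) / S"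
    by (simp add: f_def sum_divide_distrib)
  also have "\<dots> = 1"
    using S by (simp add: S_def)
  finally have "pmf (embed_pmf f) w = f w"
    using nonneg by (intro pmf_embed_pmf) auto
  moreover have "gsaw_next adj C p = embed_pmf f"
    unfolding gsaw_next_def f_def[abs_def] S_def ..
  ultimately show ?thesis
    by (simp add: f_def S_def)
qed

lemma Ionescu_Tulcea_gsaw:
  fixes adj :: "'v \<Rightarrow> 'v \<Rightarrow> bool"
  shows "Ionescu_Tulcea (gsaw_kernel adj C v) (\<lambda>_. count_space UNIV)"
proof (rule Ionescu_Tulcea.intro)
  fix n :: nat
  show "gsaw_kernel adj C v n
      \<in> PiM {0..<n} (\<lambda>_. count_space UNIV) \<rightarrow>\<^sub>M subprob_algebra (count_space UNIV)"
  proof (cases n)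
    case 0
    then show ?thesis
      by (simp add: gsaw_kernel_def[abs_def] measurable_const measure_pmf_in_subprob_algebra)
  next
    case (Suc m)
    have 1: "(\<lambda>\<omega>. \<omega> m) \<in> PiM {0..<n} (\<lambda>_. count_space UNIV) \<rightarrow>\<^sub>M count_space UNIV"
      using Suc by (intro measurable_component_singleton) auto
    have 2: "(\<lambda>p. measure_pmf (gsaw_step adj C p))
        \<in> count_space UNIV \<rightarrow>\<^sub>M subprob_algebra (count_space UNIV)"
      by (simp add: measure_pmf_in_subprob_algebra)
    show ?thesis
      using measurable_compose[OF 1 2] Suc by (simp add: gsaw_kernel_def[abs_def])
  qed
next
  fix n :: nat and \<omega> :: "nat \<Rightarrow> 'v list"
  show "prob_space (gsaw_kernel adj C v n \<omega>)"
    by (simp add: gsaw_kernel_def prob_space_measure_pmf)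
qed

lemma sets_gsaw: "sets (gsaw adj C v) = sets (PiM UNIV (\<lambda>_. count_space UNIV))"
proof -
  interpret Ionescu_Tulcea "gsaw_kernel adj C v" "\<lambda>_. count_space UNIV"
    by (rule Ionescu_Tulcea_gsaw)
  show ?thesis
    unfolding gsaw_def by (rule PF.sets_lim)
qed

lemma space_gsaw: "space (gsaw adj C v) = UNIV"
  using sets_eq_imp_space_eq[OF sets_gsaw] by (simp add: space_PiM)

lemma prob_space_gsaw: "prob_space (gsaw adj C v)"
proof -
  interpret Ionescu_Tulcea "gsaw_kernel adj C v" "\<lambda>_. count_space UNIV"
    by (rule Ionescu_Tulcea_gsaw)
  have "emeasure PF.lim (PF.emb UNIV {} {\<lambda>_. undefined}) = emeasure (CI {}) {\<lambda>_. undefined}"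
    by (intro lim) (auto simp: PiM_empty)
  also have "PF.emb UNIV {} {\<lambda>_. undefined} = UNIV"
    by (auto simp: prod_emb_def)
  also have "emeasure (CI {}) {\<lambda>_. undefined} = 1"
  proof -
    interpret CI: prob_space "CI {}"
      by (rule PF.prob_space_P) auto
    have "space (CI {}) = {\<lambda>_. undefined}"
      by (simp add: CI_def space_PiM_empty)
    then show ?thesis
      using CI.emeasure_space_1 by simp
  qed
  finally show ?thesis
    by (intro prob_spaceI) (simp add: space_gsaw, simp add: gsaw_def)
qed

lemma emeasure_gsaw_cylinder:
  fixes q :: "nat \<Rightarrow> 'v list"
  defines "Z n \<equiv> {f \<in> space (PiM {0..<n} (\<lambda>_. count_space UNIV)). \<forall>i<n. f i = q i}"
  shows "emeasure (gsaw adj c v) {\<omega>. \<forall>i<n. \<omega> i = q i} =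
     emeasure (Ionescu_Tulcea.C (gsaw_kernel adj c v) (\<lambda>_. count_space UNIV) 0 n (\<lambda>_. undefined)) (Z n)"
    and "Z n \<in> sets (PiM {0..<n} (\<lambda>_. count_space UNIV))"
proof -
  interpret Ionescu_Tulcea "gsaw_kernel adj c v" "\<lambda>_. count_space UNIV"
    by (rule Ionescu_Tulcea_gsaw)
  have "Z n = PiE {0..<n} (\<lambda>i. {q i})"
    by (auto simp: Z_def space_PiM PiE_iff extensional_def)
  then show Z: "Z n \<in> sets (PiM {0..<n} (\<lambda>_. count_space UNIV))"
    by (simp add: sets_PiM_I_finite)
  have "emeasure PF.lim (PF.emb UNIV {0..<n} (Z n)) = emeasure (CI {0..<n}) (Z n)"
    using Z by (intro lim) auto
  also have "PF.emb UNIV {0..<n} (Z n) = {\<omega>. \<forall>i<n. \<omega> i = q i}"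
    by (auto simp: prod_emb_def Z_def space_PiM)
  also have "emeasure (CI {0..<n}) (Z n)
      = emeasure (C 0 n (\<lambda>_. undefined)) (PF.emb {0..<n} {0..<n} (Z n))"
    using Z by (intro emeasure_CI) auto
  also have "PF.emb {0..<n} {0..<n} (Z n) = Z n"
    by (auto simp: prod_emb_def Z_def space_PiM)
  finally show "emeasure (gsaw adj c v) {\<omega>. \<forall>i<n. \<omega> i = q i}
      = emeasure (C 0 n (\<lambda>_. undefined)) (Z n)"
    by (simp add: gsaw_def)
qed

lemma emeasure_gsaw_cylinder_Suc:
  fixes q :: "nat \<Rightarrow> 'v list"
  shows "emeasure (gsaw adj c v) {\<omega>. \<forall>i<Suc n. \<omega> i = q i} =
     emeasure (gsaw adj c v) {\<omega>. \<forall>i<n. \<omega> i = q i} * emeasure (gsaw_kernel adj c v n q) {q n}"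
proof -
  interpret Ionescu_Tulcea "gsaw_kernel adj c v" "\<lambda>_. count_space UNIV"
    by (rule Ionescu_Tulcea_gsaw)
  define Z where
    "Z n = {f \<in> space (PiM {0..<n} (\<lambda>_. count_space UNIV)). \<forall>i<n. f i = q i}" for n
  note cyl = emeasure_gsaw_cylinder[where q = q, folded Z_def]
  let ?u = "\<lambda>_. undefined :: 'v list"
  have u: "?u \<in> space (PiM {0..<0} (\<lambda>_. count_space UNIV))"
    by (auto simp: space_PiM)
  have spC: "space (C 0 n ?u) = space (PiM {0..<n} (\<lambda>_. count_space UNIV))"
    using space_C[OF u, of n] by simp
  have setsC: "sets (C 0 n ?u) = sets (PiM {0..<n} (\<lambda>_. count_space UNIV))"
    using sets_C[OF u, of n] by simp
  have ne: "space (C 0 n ?u) \<noteq> {}"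
    by (rule prob_space.not_empty[OF prob_space_C[OF u]])
  have meas: "eP n \<in> C 0 n ?u \<rightarrow>\<^sub>M subprob_algebra (PiM {0..<Suc n} (\<lambda>_. count_space UNIV))"
    using measurable_eP[of n] by (simp add: measurable_cong_sets[OF setsC refl])
  have "emeasure (C 0 (Suc n) ?u) (Z (Suc n)) = (\<integral>\<^sup>+\<omega>. emeasure (eP n \<omega>) (Z (Suc n)) \<partial>C 0 n ?u)"
    using emeasure_bind[OF ne meas cyl(2)] by simp
  also have "\<dots> = (\<integral>\<^sup>+\<omega>. emeasure (gsaw_kernel adj c v n q) {q n} * indicator (Z n) \<omega> \<partial>C 0 n ?u)"
  proof (rule nn_integral_cong)
    fix \<omega> assume "\<omega> \<in> space (C 0 n ?u)"
    then have w: "\<omega> \<in> space (PiM {0..<n} (\<lambda>_. count_space UNIV))"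
      by (simp add: spC)
    have "emeasure (eP n \<omega>) (Z (Suc n))
        = emeasure (gsaw_kernel adj c v n \<omega>) (fun_upd \<omega> n -` Z (Suc n))"
      using emeasure_eP[OF w cyl(2)] by simp
    also have "fun_upd \<omega> n -` Z (Suc n) = (if \<omega> \<in> Z n then {q n} else {})"
      using w by (auto simp: Z_def space_PiM PiE_iff extensional_def less_Suc_eq)
    also have "emeasure (gsaw_kernel adj c v n \<omega>) \<dots>
        = emeasure (gsaw_kernel adj c v n q) {q n} * indicator (Z n) \<omega>"
      by (cases n) (auto simp: gsaw_kernel_def Z_def)
    finally show "emeasure (eP n \<omega>) (Z (Suc n))
        = emeasure (gsaw_kernel adj c v n q) {q n} * indicator (Z n) \<omega>" .
  qed
  also have "\<dots> = emeasure (gsaw_kernel adj c v n q) {q n} * emeasure (C 0 n ?u) (Z n)"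
    using cyl(2)[of n] by (intro nn_integral_cmult_indicator) (simp add: setsC)
  finally show ?thesis
    by (simp only: cyl(1) mult.commute)
qed

lemma gsaw_0: "measure (gsaw adj C v) {\<omega>. \<omega> 0 = [v]} = 1"
proof -
  interpret prob_space "gsaw adj C v" by (rule prob_space_gsaw)
  have "emeasure (gsaw adj C v) {\<omega>. \<forall>i<Suc 0. \<omega> i = [v]} = 1"
    unfolding emeasure_gsaw_cylinder_Suc[where q = "\<lambda>_. [v]"]
    using emeasure_space_1
    by (simp add: space_gsaw gsaw_kernel_def emeasure_pmf_single)
  then show ?thesis
    by (simp add: measure_def)
qed

lemma gsaw_Suc:
  "measure (gsaw adj C v) {\<omega>. \<forall>i\<le>Suc n. \<omega> i = q i} =
     measure (gsaw adj C v) {\<omega>. \<forall>i\<le>n. \<omega> i = q i} * pmf (gsaw_step adj C (q n)) (q (Suc n))"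
  using emeasure_gsaw_cylinder_Suc[of adj C v "Suc n" q]
  by (simp add: measure_def less_Suc_eq_le gsaw_kernel_def emeasure_pmf_single enn2real_mult)

lemma gsaw_terminates_measurable: "{\<omega>. gsaw_terminates adj \<omega>} \<in> sets (gsaw adj C v)"
proof -
  have "(\<lambda>\<omega>. \<omega> n) \<in> gsaw adj C v \<rightarrow>\<^sub>M count_space UNIV" for n
    unfolding measurable_cong_sets[OF sets_gsaw refl]
    by (rule measurable_component_singleton) simp
  then have "(\<lambda>\<omega>. \<omega> n) -` {p. free_neighbors adj p = {}} \<inter> space (gsaw adj C v)
      \<in> sets (gsaw adj C v)" for n
    by (rule measurable_sets) simp
  then have "(\<Union>n. (\<lambda>\<omega>. \<omega> n) -` {p. free_neighbors adj p = {}} \<inter> space (gsaw adj C v))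
      \<in> sets (gsaw adj C v)"
    by blast
  also have "(\<Union>n. (\<lambda>\<omega>. \<omega> n) -` {p. free_neighbors adj p = {}} \<inter> space (gsaw adj C v))
      = {\<omega>. gsaw_terminates adj \<omega>}"
    by (auto simp: gsaw_terminates_def space_gsaw)
  finally show ?thesis .
qed

end

theory Submission
  imports Defs
begin

text \<open>Whatever the walk has done so far, it can still be trapped, and with a probability that is
  bounded below by a constant depending on \<open>C\<close> only (\<open>trap_prob_bounded_below\<close>). A walk for which
  this stays true forever is trapped almost surely (\<open>absorption_almost_sure\<close>): if \<open>S\<close> denotes the
  probability of surviving forever, then \<open>S \<le> 1 - e\<close> at every reachable path, and averaging over
  the first \<open>n\<close> steps gives \<open>S \<le> (1 - e) \<cdot> s\<^sub>n\<close> for the probability \<open>s\<^sub>n\<close> of surviving those;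
  \<open>n \<rightarrow> \<infinity>\<close> yields \<open>S \<le> (1 - e) \<cdot> S\<close>, so that \<open>S = 0\<close>. The time needed to be trapped need
  not be bounded, and on the ladder it is not.

  The lower bound comes from the shape of walks on the ladder. The visited columns always form an
  interval \<open>{m..M}\<close>. To stand strictly between \<open>m\<close> and \<open>M\<close> the walk must be passing through a column
  for the second time, so that the vertex across is already visited, as is the one it came from in
  its own row: it has at most one move (\<open>ladder_path_step\<close>). Such a walk follows a corridor without
  any choice, until it is trapped or reaches column \<open>m\<close> or \<open>M\<close>, again with the vertex across visited.
  There it can trap itself by four moves in the fresh columns beyond: two steps outward, one step
  across, one step back (\<open>trap_prob_border\<close>). A walk standing in column \<open>m\<close> or \<open>M\<close> whose vertex
  across is free gets into the same situation by moving to that vertex. Hence at most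
  five moves involve a choice, however long the corridors are, and each of them has probability
  at least \<open>step_bound 3 C\<close>, since all degrees, and so all exponents of \<open>C\<close>, are at most 3.\<close>

section \<open>Absorption of a Markov chain\<close>

primrec run :: "('a \<Rightarrow> 'a pmf) \<Rightarrow> nat \<Rightarrow> 'a \<Rightarrow> 'a pmf" where
  "run K 0 x = return_pmf x"
| "run K (Suc n) x = bind_pmf (K x) (run K n)"

lemma emeasure_run_Suc:
  "emeasure (run K (Suc n) x) A = (\<integral>\<^sup>+y. emeasure (run K n y) A \<partial>K x)"
  by (simp add: emeasure_bind_pmf)

lemma prob_run_Suc_ge:
  "pmf (K x) y * measure_pmf.prob (run K n y) A \<le> measure_pmf.prob (run K (Suc n) x) A"
proof -
  have "ennreal (pmf (K x) y * measure_pmf.prob (run K n y) A)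
      = (\<integral>\<^sup>+z. emeasure (run K n y) A * indicator {y} z \<partial>K x)"
    by (subst nn_integral_cmult)
      (simp_all add: measure_pmf_single measure_pmf.emeasure_eq_measure ennreal_mult mult.commute)
  also have "\<dots> \<le> (\<integral>\<^sup>+z. emeasure (run K n z) A \<partial>K x)"
    by (intro nn_integral_mono) (auto simp: indicator_def)
  also have "\<dots> = ennreal (measure_pmf.prob (run K (Suc n) x) A)"
    by (metis emeasure_run_Suc measure_pmf.emeasure_eq_measure)
  finally show ?thesis
    by (subst (asm) ennreal_le_iff) auto
qed

text \<open>The number of steps after which absorption has probability \<open>e\<close> may vary with the state without
  any bound. This is why the proof compares the limit of the survival probabilities with itself,
  instead of iterating over blocks of steps of a fixed length.\<close>

lemma absorption_almost_sure:
  fixes K :: "'a \<Rightarrow> 'a pmf"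
  assumes absorbing: "\<And>x. x \<in> A \<Longrightarrow> K x = return_pmf x"
    and closed: "\<And>x y. x \<in> I \<Longrightarrow> y \<in> set_pmf (K x) \<Longrightarrow> y \<in> I"
    and "e > 0"
    and hit: "\<And>x. x \<in> I \<Longrightarrow> \<exists>n. e \<le> measure_pmf.prob (run K n x) A"
    and "x \<in> I"
  shows "(INF n. emeasure (run K n x) (- A)) = 0"
proof -
  define s where "s n x = emeasure (run K n x) (- A)" for n x
  define S where "S x = (INF n. s n x)" for x
  have s_Suc: "s (Suc n) x = (\<integral>\<^sup>+y. s n y \<partial>K x)" for n x
    unfolding s_def by (rule emeasure_run_Suc)
  have s_le_1: "s n x \<le> 1" for n x
    by (simp add: s_def measure_pmf.emeasure_le_1)
  have mono: "s (Suc n) x \<le> s n x" for n x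
  proof (induction n arbitrary: x)
    case 0
    show ?case
    proof (cases "x \<in> A")
      case True
      then show ?thesis by (simp add: s_def absorbing bind_return_pmf)
    next
      case False
      then show ?thesis using s_le_1[of "Suc 0" x] by (simp add: s_def)
    qed
  next
    case (Suc n)
    show ?case
      unfolding s_Suc[of "Suc n" x] s_Suc[of n x] by (intro nn_integral_mono Suc)
  qed
  have dec: "decseq (\<lambda>n. s n x)" for x
    by (rule decseq_SucI) (rule mono)
  have dec': "decseq s"
    by (intro decseq_SucI le_funI mono)
  \<comment> \<open>Monotone convergence for decreasing sequences needs one finite integral; \<open>s 0\<close> has it.\<close>
  have S_step: "S x \<le> (\<integral>\<^sup>+y. S y \<partial>K x)" for x
  proof -
    have "(\<integral>\<^sup>+y. s 0 y \<partial>K x) < \<infinity>"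
      using s_le_1[of "Suc 0" x] by (simp add: s_Suc[symmetric] le_less_trans)
    then have "(\<integral>\<^sup>+y. S y \<partial>K x) = (INF n. \<integral>\<^sup>+y. s n y \<partial>K x)"
      unfolding S_def by (intro nn_integral_monotone_convergence_INF_decseq dec') auto
    also have "S x \<le> \<dots>"
      unfolding s_Suc[symmetric] S_def by (intro INF_greatest INF_lower) auto
    finally show ?thesis .
  qed
  have S_le: "S x \<le> ennreal (1 - e)" if "x \<in> I" for x
  proof -
    obtain n where "e \<le> measure_pmf.prob (run K n x) A"
      using hit[OF \<open>x \<in> I\<close>] by blast
    moreover have "measure_pmf.prob (run K n x) (- A) = 1 - measure_pmf.prob (run K n x) A"
      using measure_pmf.prob_compl[of A "run K n x"] by (simp add: Compl_eq_Diff_UNIV)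
    ultimately have "s n x \<le> ennreal (1 - e)"
      unfolding s_def measure_pmf.emeasure_eq_measure by (intro ennreal_leI) simp
    then show ?thesis
      unfolding S_def by (rule INF_lower2[OF UNIV_I])
  qed
  have S_le_s: "S x \<le> ennreal (1 - e) * s n x" if "x \<in> I" for n x
    using that
  proof (induction n arbitrary: x)
    case 0
    show ?case
    proof (cases "x \<in> A")
      case True
      then have "S x \<le> 0"
        unfolding S_def by (intro INF_lower2[of 0]) (simp_all add: s_def)
      then show ?thesis by simp
    next
      case False
      then show ?thesis using S_le[OF 0] by (simp add: s_def)
    qed
  next
    case (Suc n)
    have "S x \<le> (\<integral>\<^sup>+y. S y \<partial>K x)"
      by (rule S_step)
    also have "\<dots> \<le> (\<integral>\<^sup>+y. ennreal (1 - e) * s n y \<partial>K x)"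
      using Suc closed by (intro nn_integral_mono_AE AE_pmfI) blast
    also have "\<dots> = ennreal (1 - e) * s (Suc n) x"
      by (simp add: s_Suc nn_integral_cmult)
    finally show ?case .
  qed
  have "(\<lambda>n. ennreal (1 - e) * s n x) \<longlonglongrightarrow> ennreal (1 - e) * S x"
    unfolding S_def by (intro ennreal_tendsto_cmult LIMSEQ_INF dec) simp
  then have le: "S x \<le> ennreal (1 - e) * S x"
    by (rule LIMSEQ_le_const) (use S_le_s \<open>x \<in> I\<close> in blast)
  have "S x \<le> 1"
    unfolding S_def by (rule INF_lower2[OF UNIV_I]) (rule s_le_1)
  then obtain r where r: "S x = ennreal r" "r \<ge> 0"
    by (cases "S x") (auto simp: top_unique)
  have "r = 0"
  proof (cases "e \<le> 1")
    case True
    with le r have "r \<le> (1 - e) * r"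
      by (simp add: ennreal_mult[symmetric])
    with \<open>e > 0\<close> r show ?thesis
      by (simp add: algebra_simps mult_le_0_iff)
  next
    \<comment> \<open>Here \<open>ennreal\<close> truncates \<open>1 - e\<close> to 0.\<close>
    case False
    with le r show ?thesis by (simp add: ennreal_neg)
  qed
  with r show ?thesis
    by (simp add: S_def s_def)
qed

section \<open>The law of the walk after n steps\<close>

text \<open>The Markov property of the walk on trajectories. The induction runs over the remaining number
  of steps with the history arbitrary: extending the history by its next entry splits the cylinder
  into countably many smaller ones, which is where countability of the vertex type is used.\<close>

lemma emeasure_gsaw_cylinder_run:
  fixes adj :: "'v :: countable \<Rightarrow> 'v \<Rightarrow> bool"
  shows "emeasure (gsaw adj C v) {\<omega>. (\<forall>i<Suc k. \<omega> i = q i) \<and> \<omega> (k + n) \<in> A} =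
    emeasure (gsaw adj C v) {\<omega>. \<forall>i<Suc k. \<omega> i = q i} * emeasure (run (gsaw_step adj C) n (q k)) A"
proof (induction n arbitrary: k q)
  case 0
  show ?case
  proof (cases "q k \<in> A")
    case True
    then have "{\<omega>. (\<forall>i<Suc k. \<omega> i = q i) \<and> \<omega> (k + 0) \<in> A} = {\<omega>. \<forall>i<Suc k. \<omega> i = q i}"
      by auto
    then show ?thesis using True by simp
  next
    case False
    then have "{\<omega>. (\<forall>i<Suc k. \<omega> i = q i) \<and> \<omega> (k + 0) \<in> A} = {}"
      by auto
    then show ?thesis using False by (simp only:) simp
  qed
next
  case (Suc n)
  let ?M = "gsaw adj C v" and ?K = "gsaw_step adj C"
  let ?q = "\<lambda>r. q(Suc k := r)"
  let ?B = "\<lambda>r. {\<omega>. (\<forall>i<Suc (Suc k). \<omega> i = ?q r i) \<and> \<omega> (Suc k + n) \<in> A}"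
  have [measurable]: "(\<lambda>\<omega>. \<omega> i) \<in> ?M \<rightarrow>\<^sub>M count_space UNIV" for i
    unfolding measurable_cong_sets[OF sets_gsaw refl]
    by (rule measurable_component_singleton) simp
  have B: "?B r \<in> sets ?M" for r
  proof -
    have "{\<omega> \<in> space ?M. (\<forall>i<Suc (Suc k). \<omega> i = ?q r i) \<and> \<omega> (Suc k + n) \<in> A} \<in> sets ?M"
      by measurable
    then show ?thesis by (simp add: space_gsaw)
  qed
  have "{\<omega>. (\<forall>i<Suc k. \<omega> i = q i) \<and> \<omega> (k + Suc n) \<in> A} = (\<Union>r. ?B r)"
    by (auto simp: less_Suc_eq)
  also have "emeasure ?M \<dots> = (\<integral>\<^sup>+r. emeasure ?M (?B r) \<partial>count_space UNIV)"
    using B by (intro emeasure_UN_countable) (auto simp: disjoint_family_on_def)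
  also have "\<dots> = (\<integral>\<^sup>+r. emeasure ?M {\<omega>. \<forall>i<Suc k. \<omega> i = q i} *
      (ennreal (pmf (?K (q k)) r) * emeasure (run ?K n r) A) \<partial>count_space UNIV)"
  proof (rule nn_integral_cong)
    fix r
    have "{\<omega>. \<forall>i<Suc k. \<omega> i = ?q r i} = {\<omega>. \<forall>i<Suc k. \<omega> i = q i}"
      by auto
    then show "emeasure ?M (?B r) = emeasure ?M {\<omega>. \<forall>i<Suc k. \<omega> i = q i} *
        (ennreal (pmf (?K (q k)) r) * emeasure (run ?K n r) A)"
      unfolding Suc.IH emeasure_gsaw_cylinder_Suc[of adj C v "Suc k" "?q r"]
      by (simp add: gsaw_kernel_def emeasure_pmf_single mult.assoc)
  qed
  also have "\<dots> = emeasure ?M {\<omega>. \<forall>i<Suc k. \<omega> i = q i} *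
      (\<integral>\<^sup>+r. emeasure (run ?K n r) A \<partial>?K (q k))"
    by (simp add: nn_integral_cmult nn_integral_measure_pmf)
  finally show ?case
    by (simp only: emeasure_run_Suc)
qed

text \<open>The first entry is restricted to \<open>[v]\<close>, which is an event of probability 1, in order that
  the case of a history of length 1 applies.\<close>

lemma emeasure_gsaw_run:
  fixes adj :: "'v :: countable \<Rightarrow> 'v \<Rightarrow> bool"
  shows "emeasure (gsaw adj C v) {\<omega>. \<omega> 0 = [v] \<and> \<omega> n \<in> A} =
    emeasure (run (gsaw_step adj C) n [v]) A"
proof -
  interpret prob_space "gsaw adj C v" by (rule prob_space_gsaw)
  show ?thesis
    using emeasure_gsaw_cylinder_run[of adj C v 0 "\<lambda>_. [v]" n A] gsaw_0[of adj C v]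
    by (simp add: emeasure_eq_measure)
qed

section \<open>Lower bounds for the transition probabilities\<close>

text \<open>If all degrees are at most \<open>d\<close>, then the energies lie between \<open>min 1 C ^ d\<close> and \<open>max 1 C ^ d\<close>,
  and at most \<open>d\<close> of them compete. The truncations at 1 make the two bounds valid for \<open>C < 1\<close>
  and \<open>C \<ge> 1\<close> alike.\<close>

definition step_bound :: "nat \<Rightarrow> real \<Rightarrow> real" where
  "step_bound d C = min 1 C ^ d / (real d * max 1 C ^ d)"

lemma pmf_gsaw_step:
  assumes "free_neighbors adj p \<noteq> {}"
  shows "pmf (gsaw_step adj C p) (p @ [w]) = pmf (gsaw_next adj C p) w"
  using assms pmf_map_inj'[of "\<lambda>w. p @ [w]" "gsaw_next adj C p" w]
  by (simp add: gsaw_step_def inj_def)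

lemma set_pmf_gsaw_step:
  assumes "C > 0" "finite (free_neighbors adj p)" "free_neighbors adj p \<noteq> {}"
  shows "set_pmf (gsaw_step adj C p) \<subseteq> (\<lambda>w. p @ [w]) ` free_neighbors adj p"
proof -
  have "set_pmf (gsaw_next adj C p) \<subseteq> free_neighbors adj p"
    using assms by (auto simp: set_pmf_eq pmf_gsaw_next)
  then show ?thesis
    using assms by (auto simp: gsaw_step_def)
qed

lemma pmf_gsaw_step_forced:
  assumes "C > 0" "free_neighbors adj p = {w}"
  shows "pmf (gsaw_step adj C p) (p @ [w]) = 1"
  using assms by (simp add: pmf_gsaw_step pmf_gsaw_next nn_energy_def)

lemma pmf_gsaw_step_ge:
  assumes C: "C > 0" and deg: "\<And>x. finite {y. adj x y} \<and> card {y. adj x y} \<le> d"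
    and w: "w \<in> free_neighbors adj p"
  shows "step_bound d C \<le> pmf (gsaw_step adj C p) (p @ [w])"
proof -
  let ?U = "free_neighbors adj p" and ?E = "nn_energy adj C p"
  have U: "?U \<subseteq> {y. adj (last p) y}"
    by (auto simp: free_neighbors_def)
  have fin: "finite ?U"
    using deg[of "last p"] by (simp add: finite_subset[OF U])
  have card: "card ?U \<le> d"
    using deg[of "last p"] card_mono[OF _ U] by linarith
  have k: "card {u \<in> set p - {last p}. adj x u} \<le> d" for x
  proof -
    have "card {u \<in> set p - {last p}. adj x u} \<le> card {y. adj x y}"
      using deg[of x] by (intro card_mono) auto
    then show ?thesis
      using deg[of x] by linarith
  qed
  have lower: "min 1 C ^ d \<le> ?E x" for x
  proof -
    have "min 1 C ^ d \<le> min 1 C ^ card {u \<in> set p - {last p}. adj x u}"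
      using C by (intro power_decreasing k) auto
    also have "\<dots> \<le> ?E x"
      unfolding nn_energy_def using C by (intro power_mono) auto
    finally show ?thesis .
  qed
  have upper: "?E x \<le> max 1 C ^ d" for x
  proof -
    have "?E x \<le> max 1 C ^ card {u \<in> set p - {last p}. adj x u}"
      unfolding nn_energy_def using C by (intro power_mono) auto
    also have "\<dots> \<le> max 1 C ^ d"
      by (intro power_increasing k) auto
    finally show ?thesis .
  qed
  have pos: "?E x > 0" for x
    using C by (simp add: nn_energy_def)
  have "sum ?E ?U \<le> real (card ?U) * max 1 C ^ d"
    by (rule sum_bounded_above[OF upper])
  also have "\<dots> \<le> real d * max 1 C ^ d"
    using card by (intro mult_right_mono) auto
  finally have sum_le: "sum ?E ?U \<le> real d * max 1 C ^ d" .
  have "sum ?E ?U > 0"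
    using w fin pos by (intro sum_pos) auto
  with lower sum_le pos have "step_bound d C \<le> ?E w / sum ?E ?U"
    unfolding step_bound_def by (intro frac_le) (auto intro: less_imp_le)
  moreover have "?U \<noteq> {}"
    using w by auto
  ultimately show ?thesis
    using w fin C by (simp add: pmf_gsaw_step pmf_gsaw_next)
qed

section \<open>Self-avoiding walks on the ladder\<close>

abbreviation across :: "int \<times> nat \<Rightarrow> int \<times> nat" where
  "across x \<equiv> (fst x, 3 - snd x)"

lemma ladder_adj_iff:
  assumes "x \<in> ladder_verts"
  shows "ladder_adj x y \<longleftrightarrow> y = (fst x - 1, snd x) \<or> y = (fst x + 1, snd x) \<or> y = across x"
  using assms by (cases x; cases y) (auto simp: ladder_adj_def ladder_verts_def)

lemma ladder_degree: "finite {y. ladder_adj x y} \<and> card {y. ladder_adj x y} \<le> 3"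
proof (cases "x \<in> ladder_verts")
  case True
  have "{y. ladder_adj x y} = set [(fst x - 1, snd x), (fst x + 1, snd x), across x]"
    by (auto simp: ladder_adj_iff[OF True])
  then show ?thesis
    using card_length[of "[(fst x - 1, snd x), (fst x + 1, snd x), across x]"] by simp
next
  case False
  then show ?thesis by (simp add: ladder_adj_def)
qed

lemma ladder_same_column:
  assumes "x \<in> ladder_verts" "y \<in> ladder_verts" "fst x = fst y"
  shows "x = y \<or> x = across y"
  using assms by (cases x; cases y) (auto simp: ladder_verts_def)

text \<open>An invariant that records only what decides the possible moves. The interval \<open>{m..M}\<close> of visited
  columns separates fresh columns from used ones. Strictly inside it, two of the three neighbors of
  the current vertex are required to be visited, so that at most one move is left.\<close>

definition ladder_path :: "int \<Rightarrow> int \<Rightarrow> (int \<times> nat) list \<Rightarrow> bool" where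
  "ladder_path m M p \<longleftrightarrow> p \<noteq> [] \<and> set p \<subseteq> ladder_verts \<and> fst ` set p = {m..M} \<and>
     (m < fst (last p) \<and> fst (last p) < M \<longrightarrow>
        across (last p) \<in> set p \<and>
        ((fst (last p) - 1, snd (last p)) \<in> set p \<or> (fst (last p) + 1, snd (last p)) \<in> set p))"

lemma free_neighbors_ladder:
  assumes "ladder_path m M p"
  shows "free_neighbors ladder_adj p =
    {(fst (last p) - 1, snd (last p)), (fst (last p) + 1, snd (last p)), across (last p)} - set p"
proof -
  have "last p \<in> ladder_verts"
    using assms last_in_set unfolding ladder_path_def by blast
  then show ?thesis
    by (auto simp: free_neighbors_def ladder_adj_iff)
qed

text \<open>If the new vertex lies strictly inside the interval, then the last move was not across: a walk
  strictly inside has the vertex across visited already. So it was horizontal and leaves a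
  visited vertex behind in the same row. Moreover the column entered was visited before, and its
  visited vertex can only be the one across.\<close>

lemma ladder_path_step:
  assumes p: "ladder_path m M p" and w: "w \<in> free_neighbors ladder_adj p"
  shows "ladder_path (min m (fst w)) (max M (fst w)) (p @ [w])"
proof -
  define a b where "a = fst (last p)" and "b = snd (last p)"
  have last: "last p = (a, b)" "(a, b) \<in> set p"
    using p by (auto simp: a_def b_def ladder_path_def)
  have w_free: "w \<notin> set p" and w_cases: "w = (a - 1, b) \<or> w = (a + 1, b) \<or> w = (a, 3 - b)"
    using w unfolding free_neighbors_ladder[OF p] by (auto simp: last)
  have verts: "set p \<subseteq> ladder_verts" and cols: "fst ` set p = {m..M}"
    using p by (auto simp: ladder_path_def)
  have a: "m \<le> a" "a \<le> M"
    using cols last by force+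
  have w_verts: "w \<in> ladder_verts"
    using w by (auto simp: free_neighbors_def ladder_adj_def)
  have "fst ` set (p @ [w]) = {min m (fst w)..max M (fst w)}"
    using cols w_cases a by auto
  moreover have "across w \<in> set (p @ [w]) \<and>
      ((fst w - 1, snd w) \<in> set (p @ [w]) \<or> (fst w + 1, snd w) \<in> set (p @ [w]))"
    if inside: "min m (fst w) < fst w" "fst w < max M (fst w)"
  proof -
    have w_in: "m < fst w" "fst w < M"
      using inside by auto
    have "w \<noteq> (a, 3 - b)"
      using p w_free w_in by (auto simp: ladder_path_def last)
    moreover have "across w \<in> set p"
    proof -
      have "fst w \<in> fst ` set p"
        using w_in cols by simp
      then obtain u where "u \<in> set p" "fst u = fst w"
        by auto
      then show ?thesis
        using ladder_same_column[of u w] verts w_verts w_free by auto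
    qed
    ultimately show ?thesis
      using w_cases last by auto
  qed
  ultimately show ?thesis
    using verts w_verts by (simp add: ladder_path_def)
qed

section \<open>Trapping the walk\<close>

definition trapped :: "(int \<times> nat) list set" where
  "trapped = {p. free_neighbors ladder_adj p = {}}"

definition trap_prob :: "real \<Rightarrow> nat \<Rightarrow> (int \<times> nat) list \<Rightarrow> real" where
  "trap_prob C n p = measure_pmf.prob (run (gsaw_step ladder_adj C) n p) trapped"

context
  fixes C :: real
  assumes C: "C > 0"
begin

lemma trap_prob_0: "p \<in> trapped \<Longrightarrow> trap_prob C 0 p = 1"
  by (simp add: trap_prob_def)

lemma step_bound_ladder: "0 < step_bound 3 C" "step_bound 3 C \<le> 1"
proof -
  show "0 < step_bound 3 C"
    using C by (simp add: step_bound_def)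
  have "min 1 C ^ 3 \<le> 1"
    using C by (intro power_le_one) auto
  moreover have "1 \<le> max 1 C ^ 3"
    by (intro one_le_power) auto
  ultimately have "min 1 C ^ 3 \<le> 3 * max 1 C ^ 3"
    by linarith
  then show "step_bound 3 C \<le> 1"
    by (simp add: step_bound_def)
qed

lemma trap_prob_Suc:
  assumes "w \<in> free_neighbors ladder_adj p" "e \<le> trap_prob C n (p @ [w])" "0 \<le> e"
  shows "step_bound 3 C * e \<le> trap_prob C (Suc n) p"
proof -
  have "step_bound 3 C * e \<le> pmf (gsaw_step ladder_adj C p) (p @ [w]) * trap_prob C n (p @ [w])"
    using assms step_bound_ladder pmf_gsaw_step_ge[OF C ladder_degree assms(1)]
    by (intro mult_mono) auto
  also have "\<dots> \<le> trap_prob C (Suc n) p"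
    unfolding trap_prob_def by (rule prob_run_Suc_ge)
  finally show ?thesis .
qed

lemma trap_prob_Suc_forced:
  assumes "free_neighbors ladder_adj p = {w}"
  shows "trap_prob C n (p @ [w]) \<le> trap_prob C (Suc n) p"
  using prob_run_Suc_ge[of "gsaw_step ladder_adj C" p "p @ [w]" n trapped]
    pmf_gsaw_step_forced[OF C assms] by (simp add: trap_prob_def)

text \<open>The moves \<open>w1\<close>, ..., \<open>w4\<close> form a U-turn in the two fresh columns on the side \<open>s\<close>. It ends next to
  \<open>(a, 3 - b)\<close>, the vertex across the current one, and since that vertex is visited, the walk is
  stuck in the pocket.\<close>

lemma trap_prob_border:
  fixes s :: int
  assumes last: "last p = (a, b)" and b: "b = 1 \<or> b = 2"
    and across: "(a, 3 - b) \<in> set p"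
    and s: "s = 1 \<or> s = - 1"
    and outside: "\<And>x. x \<in> set p \<Longrightarrow> fst x \<noteq> a + s \<and> fst x \<noteq> a + 2 * s"
  shows "step_bound 3 C ^ 4 \<le> trap_prob C 4 p"
proof -
  define w1 w2 w3 w4 where w_def:
    "w1 = (a + s, b)" "w2 = (a + 2 * s, b)" "w3 = (a + 2 * s, 3 - b)" "w4 = (a + s, 3 - b)"
  have out: "(a + s, c) \<notin> set p" "(a + 2 * s, c) \<notin> set p" for c
    using outside by force+
  have "s \<noteq> 0" and "b \<noteq> 3 - b"
    using s b by auto
  note new = out this
  have verts: "(x, b) \<in> ladder_verts" "(x, 3 - b) \<in> ladder_verts" for x
    using b by (auto simp: ladder_verts_def)
  have "3 - (3 - b) = b"
    using b by auto
  note adj = verts[THEN ladder_adj_iff] this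
  have 1: "w1 \<in> free_neighbors ladder_adj p"
    using s new by (auto simp: free_neighbors_def adj last w_def)
  have 2: "w2 \<in> free_neighbors ladder_adj (p @ [w1])"
    using s new by (auto simp: free_neighbors_def adj w_def)
  have 3: "w3 \<in> free_neighbors ladder_adj ((p @ [w1]) @ [w2])"
    using new by (simp add: free_neighbors_def adj w_def)
  have 4: "w4 \<in> free_neighbors ladder_adj (((p @ [w1]) @ [w2]) @ [w3])"
    using s new by (auto simp: free_neighbors_def adj w_def)
  have "(((p @ [w1]) @ [w2]) @ [w3]) @ [w4] \<in> trapped"
    using s across by (auto simp: trapped_def free_neighbors_def adj w_def)
  then have "1 \<le> trap_prob C 0 ((((p @ [w1]) @ [w2]) @ [w3]) @ [w4])"
    by (simp add: trap_prob_0)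
  note t4 = trap_prob_Suc[OF 4 this zero_le_one]
  note t3 = trap_prob_Suc[OF 3 t4]
  note t2 = trap_prob_Suc[OF 2 t3]
  note t1 = trap_prob_Suc[OF 1 t2]
  show ?thesis
    using t1 step_bound_ladder by (simp add: eval_nat_numeral mult.assoc)
qed

text \<open>Strictly inside the visited interval the next move is forced, hence costs no probability, and
  leads to a vertex whose column has been visited, so that the hypotheses persist with the same
  \<open>m\<close> and \<open>M\<close>. Each forced move uses up a free vertex of these columns, which makes the induction
  terminate.\<close>

lemma trap_prob_blocked:
  assumes "ladder_path m M p" "across (last p) \<in> set p"
  shows "\<exists>n. step_bound 3 C ^ 4 \<le> trap_prob C n p"
  using assms
proof (induction "card ({m..M} \<times> {1, 2} - set p)" arbitrary: p rule: less_induct)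
  case less
  let ?free = "free_neighbors ladder_adj p"
  define a b where "a = fst (last p)" and "b = snd (last p)"
  have last: "last p = (a, b)" "(a, b) \<in> set p"
    using less.prems by (auto simp: a_def b_def ladder_path_def)
  have cols: "fst ` set p = {m..M}" and verts: "set p \<subseteq> ladder_verts"
    using less.prems by (auto simp: ladder_path_def)
  have b: "b = 1 \<or> b = 2"
    using verts last by (auto simp: ladder_verts_def)
  have across: "(a, 3 - b) \<in> set p"
    using less.prems by (simp add: last)
  have col: "m \<le> fst x \<and> fst x \<le> M" if "x \<in> set p" for x
    using that cols by (metis atLeastAtMost_iff imageI)
  have a: "m \<le> a" "a \<le> M"
    using col[OF last(2)] by auto
  consider (trapped) "?free = {}" | (left) "a = m" | (right) "a = M"
    | (inside) "?free \<noteq> {}" "m < a" "a < M"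
    using a by linarith
  then show ?case
  proof cases
    case trapped
    then have "trap_prob C 0 p = 1"
      by (intro trap_prob_0) (simp add: trapped_def)
    then show ?thesis
      using step_bound_ladder by (intro exI[of _ 0]) (simp add: power_le_one)
  next
    case left
    have "step_bound 3 C ^ 4 \<le> trap_prob C 4 p"
      using col left by (intro trap_prob_border[OF last(1) b across, of "- 1"]) force+
    then show ?thesis ..
  next
    case right
    have "step_bound 3 C ^ 4 \<le> trap_prob C 4 p"
      using col right by (intro trap_prob_border[OF last(1) b across, of 1]) force+
    then show ?thesis ..
  next
    case inside
    have "(a - 1, b) \<in> set p \<or> (a + 1, b) \<in> set p"
      using less.prems inside by (simp add: ladder_path_def last)
    moreover have free: "?free = {(a - 1, b), (a + 1, b), (a, 3 - b)} - set p"
      using free_neighbors_ladder[OF less.prems(1)] by (simp add: last)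
    ultimately obtain w where w: "?free = {w}" and w_cases: "w = (a - 1, b) \<or> w = (a + 1, b)"
      using across inside(1) by auto
    have w_col: "m \<le> fst w" "fst w \<le> M" and w_free: "w \<notin> set p"
      using w_cases inside w free by auto
    have w_verts: "w \<in> {m..M} \<times> {1, 2}"
      using w_col w_cases b by auto
    have path: "ladder_path m M (p @ [w])"
      using ladder_path_step[OF less.prems(1), of w] w w_col by (simp add: min_absorb1 max_absorb1)
    have "fst w \<in> fst ` set p"
      using w_col cols by simp
    then obtain u where "u \<in> set p" "fst u = fst w"
      by auto
    then have "across w \<in> set p"
      using ladder_same_column[of u w] verts w_verts w_free by (auto simp: ladder_verts_def)
    then have blocked: "across (last (p @ [w])) \<in> set (p @ [w])"
      by simp
    have "card ({m..M} \<times> {1, 2} - set (p @ [w])) < card ({m..M} \<times> {1, 2} - set p)"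
      using w_verts w_free by (intro psubset_card_mono) auto
    from less.hyps[OF this path blocked]
    obtain n where "step_bound 3 C ^ 4 \<le> trap_prob C n (p @ [w])" ..
    then have "step_bound 3 C ^ 4 \<le> trap_prob C (Suc n) p"
      using trap_prob_Suc_forced[OF w, of n] by linarith
    then show ?thesis ..
  qed
qed

text \<open>If the vertex across is free, moving there makes the vertex just left the visited one across.
  This extra move accounts for the exponent 5.\<close>

lemma trap_prob_bounded_below:
  assumes "ladder_path m M p"
  shows "\<exists>n. step_bound 3 C ^ 5 \<le> trap_prob C n p"
proof (cases "across (last p) \<in> set p")
  case True
  from trap_prob_blocked[OF assms this] obtain n where "step_bound 3 C ^ 4 \<le> trap_prob C n p" ..
  moreover have "step_bound 3 C ^ 5 \<le> step_bound 3 C ^ 4"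
    using step_bound_ladder by (intro power_decreasing) auto
  ultimately show ?thesis
    by (meson order_trans)
next
  case False
  let ?w = "across (last p)"
  have w: "?w \<in> free_neighbors ladder_adj p"
    using False by (simp add: free_neighbors_ladder[OF assms])
  have last: "last p \<in> set p" "last p \<in> ladder_verts"
    using assms last_in_set unfolding ladder_path_def by blast+
  then have "across ?w = last p"
    by (cases "last p") (auto simp: ladder_verts_def)
  with last have "across (last (p @ [?w])) \<in> set (p @ [?w])"
    by simp
  from trap_prob_blocked[OF ladder_path_step[OF assms w] this]
  obtain n where "step_bound 3 C ^ 4 \<le> trap_prob C n (p @ [?w])" ..
  from trap_prob_Suc[OF w this] show ?thesis
    using step_bound_ladder by (intro exI[of _ "Suc n"]) (simp add: eval_nat_numeral)
qed

end

theorem corollary2p60: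
  fixes C :: real and v :: "int \<times> nat"
  assumes "C > 0" and "v \<in> ladder_verts"
  shows "\<P>(\<omega> in gsaw ladder_adj C v. gsaw_terminates ladder_adj \<omega>) = 1"
proof -
  let ?M = "gsaw ladder_adj C v" and ?K = "gsaw_step ladder_adj C"
  interpret prob_space ?M by (rule prob_space_gsaw)
  let ?T = "{\<omega>. gsaw_terminates ladder_adj \<omega>}"
  let ?I = "{p. \<exists>m M. ladder_path m M p}"
  have "(INF n. emeasure (run ?K n [v]) (- trapped)) = 0"
  proof (rule absorption_almost_sure[where I = ?I])
    show "?K p = return_pmf p" if "p \<in> trapped" for p
      using that by (simp add: trapped_def gsaw_step_def)
    show "q \<in> ?I" if "p \<in> ?I" "q \<in> set_pmf (?K p)" for p q
    proof (cases "free_neighbors ladder_adj p = {}")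
      case True
      with that show ?thesis by (simp add: gsaw_step_def)
    next
      case False
      from that set_pmf_gsaw_step[OF \<open>C > 0\<close> finite_free_neighbors_ladder False]
      obtain w where "w \<in> free_neighbors ladder_adj p" "q = p @ [w]"
        by blast
      with that ladder_path_step show ?thesis by blast
    qed
    show "0 < step_bound 3 C ^ 5"
      using step_bound_ladder[OF \<open>C > 0\<close>] by simp
    show "\<exists>n. step_bound 3 C ^ 5 \<le> measure_pmf.prob (run ?K n p) trapped" if "p \<in> ?I" for p
      using that trap_prob_bounded_below[OF \<open>C > 0\<close>] by (auto simp: trap_prob_def)
    have "ladder_path (fst v) (fst v) [v]"
      using \<open>v \<in> ladder_verts\<close> by (simp add: ladder_path_def)
    then show "[v] \<in> ?I" by blast
  qed
  moreover have "ennreal (1 - prob ?T) \<le> emeasure (run ?K n [v]) (- trapped)" for n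
  proof -
    have "{\<omega>. \<omega> 0 = [v] \<and> \<omega> n \<in> trapped} \<subseteq> ?T"
      by (auto simp: trapped_def gsaw_terminates_def)
    then have "emeasure (run ?K n [v]) trapped \<le> emeasure ?M ?T"
      unfolding emeasure_gsaw_run[symmetric]
      by (intro emeasure_mono gsaw_terminates_measurable)
    then have "measure_pmf.prob (run ?K n [v]) trapped \<le> prob ?T"
      by (simp add: emeasure_eq_measure measure_pmf.emeasure_eq_measure)
    moreover have "measure_pmf.prob (run ?K n [v]) (- trapped)
        = 1 - measure_pmf.prob (run ?K n [v]) trapped"
      using measure_pmf.prob_compl[of trapped "run ?K n [v]"] by (simp add: Compl_eq_Diff_UNIV)
    ultimately show ?thesis
      by (simp add: measure_pmf.emeasure_eq_measure)
  qed
  then have "ennreal (1 - prob ?T) \<le> (INF n. emeasure (run ?K n [v]) (- trapped))"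
    by (intro INF_greatest)
  ultimately have "prob ?T \<ge> 1"
    by simp
  then show ?thesis
    using prob_le_1[of ?T] by (intro antisym) (simp_all add: space_gsaw)
qed

end
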